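(* If $\mathrm{DegNSEP}^* > 0$, then: (i) there is a unique optimal solution $\beta^*$ of the logistic regression problem $\min_{\beta\in\mathbb{R}^p} L_n(\beta)$; (ii) $H(\beta^* ) \succ 0$; (iii) $\|\beta^*\| \le \dfrac{L_n^*}{\mathrm{DegNSEP}^*} \le \dfrac{\ln(2)}{\mathrm{DegNSEP}^*}$; and (iv) $\mathrm{Dist}_0 \le \dfrac{\ln(2)+L_n^*}{\mathrm{DegNSEP}^*} \le \dfrac{2\ln(2)}{\mathrm{DegNSEP}^*}$.
   Context: Let $(\mathbf{x}_1,y_1),\ldots,(\mathbf{x}_n,y_n)$ be data with $\mathbf{x}_i\in\mathbb{R}^p$, $y_i\in\{-1,1\}$, and let $\|\cdot\|$ be a given (arbitrary) norm on $\mathbb{R}^p$. The logistic loss function is $L_n(\beta) := \frac1n\sum_{i=1}^n \ln(1+\exp(-y_i\beta^T\mathbf{x}_i))$, $L_n^* := \inf_{\beta\in\mathbb{R}^p} L_n(\beta)$, and $H(\beta)$ denotes the Hessian of $L_n$ at $\beta$. For a scalar $t$, $[t]^- := \max\{-t,0\}$ is its negative part. The degree of non-separability of the data is $$\mathrm{DegNSEP}^* := \min_{\beta\in\mathbb{R}^p:\ \|\beta\|=1}\ \frac1n\sum_{i=1}^n [y_i\beta^T\mathbf{x}_i]^-.$$ Noting $L_n(0)=\ln(2)$, define $$\mathrm{Dist}_0 := \max_{\beta:\ L_n(\beta)\le \ln(2)}\ \Big\{\min_{\beta^*:\ L_n(\beta^* )=L_n^*}\|\beta-\beta^*\|\Big\}.$$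 *)

theory Defs
  imports "HOL-Analysis.Analysis"
begin

(* An arbitrary norm, as opposed to the Euclidean norm provided by the type class. *)
definition is_norm :: "('a::real_vector \<Rightarrow> real) \<Rightarrow> bool" where
  "is_norm N \<longleftrightarrow>
     (\<forall>v. 0 \<le> N v) \<and> (\<forall>v. N v = 0 \<longleftrightarrow> v = 0) \<and>
     (\<forall>c v. N (c *\<^sub>R v) = \<bar>c\<bar> * N v) \<and> (\<forall>v w. N (v + w) \<le> N v + N w)"

definition partial_deriv :: "'p \<Rightarrow> (real ^ 'p \<Rightarrow> real) \<Rightarrow> real ^ 'p \<Rightarrow> real" where
  "partial_deriv i f b = deriv (\<lambda>t. f (b + t *\<^sub>R axis i 1)) 0"

definition hessian :: "(real ^ 'p \<Rightarrow> real) \<Rightarrow> real ^ 'p \<Rightarrow> real ^ 'p ^ 'p" where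
  "hessian f b = (\<chi> i j. partial_deriv i (partial_deriv j f) b)"

definition pos_def :: "real ^ 'p ^ 'p \<Rightarrow> bool" where
  "pos_def A \<longleftrightarrow> transpose A = A \<and> (\<forall>v. v \<noteq> 0 \<longrightarrow> 0 < v \<bullet> (A *v v))"

definition neg_part :: "real \<Rightarrow> real" where
  "neg_part t = max (- t) 0"

definition logistic_loss ::
  "nat \<Rightarrow> (nat \<Rightarrow> real ^ 'p) \<Rightarrow> (nat \<Rightarrow> real) \<Rightarrow> real ^ 'p \<Rightarrow> real" where
  "logistic_loss n x y b = 1 / real n * (\<Sum>i=1..n. ln (1 + exp (- y i * (b \<bullet> x i))))"

definition opt_loss :: "nat \<Rightarrow> (nat \<Rightarrow> real ^ 'p) \<Rightarrow> (nat \<Rightarrow> real) \<Rightarrow> real" where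
  "opt_loss n x y = (INF b. logistic_loss n x y b)"

(* The infimum is attained, see deg_nsep_attained. *)
definition deg_nsep ::
  "(real ^ 'p \<Rightarrow> real) \<Rightarrow> nat \<Rightarrow> (nat \<Rightarrow> real ^ 'p) \<Rightarrow> (nat \<Rightarrow> real) \<Rightarrow> real" where
  "deg_nsep N n x y =
     (INF b\<in>{b. N b = 1}. 1 / real n * (\<Sum>i=1..n. neg_part (y i * (b \<bullet> x i))))"

definition dist_opt ::
  "(real ^ 'p \<Rightarrow> real) \<Rightarrow> nat \<Rightarrow> (nat \<Rightarrow> real ^ 'p) \<Rightarrow> (nat \<Rightarrow> real) \<Rightarrow> real ^ 'p \<Rightarrow> real" where
  "dist_opt N n x y b =
     (INF bs\<in>{bs. logistic_loss n x y bs = opt_loss n x y}. N (b - bs))"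

(* Under the hypothesis deg_nsep > 0 this supremum and the infimum inside it are a maximum
   and a minimum, see dist_opt_attained and dist0_attained; without such a hypothesis they
   could be the arbitrary value of Sup or Inf on an unbounded or empty set of reals. *)
definition dist0 ::
  "(real ^ 'p \<Rightarrow> real) \<Rightarrow> nat \<Rightarrow> (nat \<Rightarrow> real ^ 'p) \<Rightarrow> (nat \<Rightarrow> real) \<Rightarrow> real" where
  "dist0 N n x y = (SUP b\<in>{b. logistic_loss n x y b \<le> ln 2}. dist_opt N n x y b)"


lemma is_norm_continuous:
  fixes N :: "real ^ 'p \<Rightarrow> real"
  assumes "is_norm N"
  shows "continuous_on S N"
proof -
  have "convex_on UNIV N"
  proof (rule convex_onI)
    fix t :: real and u v :: "real ^ 'p"
    assume t: "0 < t" "t < 1"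
    have "N ((1 - t) *\<^sub>R u + t *\<^sub>R v) \<le> N ((1 - t) *\<^sub>R u) + N (t *\<^sub>R v)"
      using assms unfolding is_norm_def by blast
    also have "\<dots> = (1 - t) * N u + t * N v"
      using assms t unfolding is_norm_def by simp
    finally show "N ((1 - t) *\<^sub>R u + t *\<^sub>R v) \<le> (1 - t) * N u + t * N v" .
  qed simp
  then have "continuous_on UNIV N"
    by (intro convex_on_continuous) auto
  then show ?thesis
    by (rule continuous_on_subset) simp
qed

lemma is_norm_minus_commute:
  assumes "is_norm N"
  shows "N (u - v) = N (v - u)"
proof -
  have "N ((-1) *\<^sub>R (u - v)) = \<bar>-1\<bar> * N (u - v)"
    using assms unfolding is_norm_def by blast
  then show ?thesis by simp
qed

lemma is_norm_ge_norm:
  fixes N :: "real ^ 'p \<Rightarrow> real"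
  assumes "is_norm N"
  obtains c where "0 < c" "\<And>v. c * norm v \<le> N v"
proof -
  have "axis undefined 1 \<in> sphere (0 :: real ^ 'p) 1" by simp
  then have "sphere (0 :: real ^ 'p) 1 \<noteq> {}" by blast
  then obtain u where u: "u \<in> sphere 0 1" "\<And>v. v \<in> sphere 0 1 \<Longrightarrow> N u \<le> N v"
    using continuous_attains_inf[OF compact_sphere _ is_norm_continuous[OF assms]] by metis
  have "u \<noteq> 0" using u(1) by auto
  then have "0 < N u" using assms unfolding is_norm_def by (metis less_le)
  moreover have "N u * norm v \<le> N v" for v
  proof (cases "v = 0")
    case True
    then show ?thesis using assms unfolding is_norm_def by simp
  next
    case False
    then have "N u \<le> N ((1 / norm v) *\<^sub>R v)" by (intro u(2)) simp
    also have "\<dots> = N v / norm v" using assms unfolding is_norm_def by simp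
    finally show ?thesis using False by (simp add: field_simps)
  qed
  ultimately show thesis by (rule that)
qed

lemma is_norm_bounded:
  fixes N :: "real ^ 'p \<Rightarrow> real"
  assumes "is_norm N" "\<And>v. v \<in> S \<Longrightarrow> N v \<le> r"
  shows "bounded S"
proof -
  obtain c where c: "0 < c" "\<And>v. c * norm v \<le> N v"
    using is_norm_ge_norm[OF assms(1)] by blast
  have "norm v \<le> r / c" if "v \<in> S" for v
    using c(1) order_trans[OF c(2) assms(2)[OF that]] by (simp add: field_simps)
  then show ?thesis by (auto simp: bounded_iff)
qed

lemma deg_nsep_attained:
  fixes N :: "real ^ 'p \<Rightarrow> real"
  assumes "is_norm N"
  shows "\<exists>b. N b = 1 \<and> deg_nsep N n x y = 1 / real n * (\<Sum>i=1..n. neg_part (y i * (b \<bullet> x i)))"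
    and "N b = 1 \<Longrightarrow> deg_nsep N n x y \<le> 1 / real n * (\<Sum>i=1..n. neg_part (y i * (b \<bullet> x i)))"
proof -
  define f where "f = (\<lambda>b. 1 / real n * (\<Sum>i=1..n. neg_part (y i * (b \<bullet> x i))))"
  have cont: "continuous_on S f" for S
    unfolding f_def neg_part_def by (intro continuous_intros)
  have "closed {b. N b = 1}"
    using continuous_closed_preimage_constant[OF is_norm_continuous[OF assms], of UNIV 1] by simp
  moreover have "bounded {b. N b = 1}"
    by (rule is_norm_bounded[OF assms, of _ 1]) simp
  ultimately have comp: "compact {b. N b = 1}"
    by (simp add: compact_eq_bounded_closed)
  have "axis undefined 1 \<noteq> (0 :: real ^ 'p)" by simp
  then have "N (axis undefined 1) \<noteq> 0" "0 \<le> N (axis undefined 1)"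
    using assms unfolding is_norm_def by blast+
  then have "N ((1 / N (axis undefined 1)) *\<^sub>R axis undefined 1) = 1"
    using assms unfolding is_norm_def by simp
  then have "{b. N b = 1} \<noteq> {}" by blast
  then obtain u where u: "N u = 1" "\<And>b. N b = 1 \<Longrightarrow> f u \<le> f b"
    using continuous_attains_inf[OF comp _ cont] by auto
  have "deg_nsep N n x y = Inf (f ` {b. N b = 1})"
    by (simp add: deg_nsep_def f_def)
  also have "\<dots> = f u"
    by (rule cInf_eq_minimum) (use u in auto)
  finally have "deg_nsep N n x y = f u" .
  with u show "\<exists>b. N b = 1 \<and> deg_nsep N n x y = 1 / real n * (\<Sum>i=1..n. neg_part (y i * (b \<bullet> x i)))"
    and "N b = 1 \<Longrightarrow> deg_nsep N n x y \<le> 1 / real n * (\<Sum>i=1..n. neg_part (y i * (b \<bullet> x i)))"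
    unfolding f_def by auto
qed

lemma deg_nsep_le_logistic_loss:
  fixes N :: "real ^ 'p \<Rightarrow> real"
  assumes "is_norm N"
  shows "deg_nsep N n x y * N b \<le> logistic_loss n x y b"
proof -
  have ln_ge: "neg_part t \<le> ln (1 + exp (- t))" for t
  proof -
    have "- t = ln (exp (- t))" by simp
    also have "\<dots> \<le> ln (1 + exp (- t))" by (subst ln_le_cancel_iff) (auto simp: add_pos_pos)
    finally show ?thesis by (simp add: neg_part_def)
  qed
  have ge: "1 / real n * (\<Sum>i=1..n. neg_part (y i * (b \<bullet> x i))) \<le> logistic_loss n x y b"
    unfolding logistic_loss_def
    by (intro mult_left_mono sum_mono) (use ln_ge[of "y _ * (b \<bullet> x _)"] in auto)
  show ?thesis
  proof (cases "b = 0")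
    case True
    have "N 0 = 0" using assms unfolding is_norm_def by blast
    moreover have "0 \<le> 1 / real n * (\<Sum>i=1..n. neg_part (y i * (b \<bullet> x i)))"
      by (intro mult_nonneg_nonneg sum_nonneg) (auto simp: neg_part_def)
    ultimately show ?thesis using ge True by simp
  next
    case False
    then have Nb: "0 < N b" using assms unfolding is_norm_def by (metis less_le)
    have scale: "neg_part (y i * ((1 / N b) *\<^sub>R b \<bullet> x i)) = neg_part (y i * (b \<bullet> x i)) / N b" for i
      using Nb by (auto simp: neg_part_def max_def field_simps)
    have "N ((1 / N b) *\<^sub>R b) = \<bar>1 / N b\<bar> * N b"
      using assms unfolding is_norm_def by blast
    also have "\<dots> = 1" using Nb by simp
    finally have "deg_nsep N n x y \<le>
        1 / real n * (\<Sum>i=1..n. neg_part (y i * ((1 / N b) *\<^sub>R b \<bullet> x i)))"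
      by (rule deg_nsep_attained(2)[OF assms])
    also have "\<dots> = (1 / real n * (\<Sum>i=1..n. neg_part (y i * (b \<bullet> x i)))) / N b"
      by (simp only: scale sum_divide_distrib[symmetric] times_divide_eq_right)
    also have "\<dots> \<le> logistic_loss n x y b / N b"
      using ge Nb by (intro divide_right_mono) auto
    finally show ?thesis using Nb by (simp add: pos_le_divide_eq)
  qed
qed

lemma continuous_on_logistic_loss: "continuous_on S (logistic_loss n x y)"
proof -
  have "1 + exp t \<noteq> 0" for t :: real
    using exp_gt_zero[of t] by linarith
  then show ?thesis
    unfolding logistic_loss_def[abs_def] by (intro continuous_intros) auto
qed

lemma compact_sublevel_logistic_loss:
  fixes N :: "real ^ 'p \<Rightarrow> real"
  assumes "is_norm N" "0 < deg_nsep N n x y"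
  shows "compact {b. logistic_loss n x y b \<le> c}"
proof -
  have "N b \<le> c / deg_nsep N n x y" if "logistic_loss n x y b \<le> c" for b
    using order_trans[OF deg_nsep_le_logistic_loss[OF assms(1)] that] assms(2)
    by (simp add: field_simps)
  then have "bounded {b. logistic_loss n x y b \<le> c}"
    by (intro is_norm_bounded[OF assms(1), of _ "c / deg_nsep N n x y"]) simp
  moreover have "closed {b. logistic_loss n x y b \<le> c}"
    by (intro closed_Collect_le continuous_on_logistic_loss continuous_on_const)
  ultimately show ?thesis by (simp add: compact_eq_bounded_closed)
qed

lemma compact_optimal_logistic_loss:
  fixes N :: "real ^ 'p \<Rightarrow> real"
  assumes "is_norm N" "0 < deg_nsep N n x y"
  shows "compact {b. logistic_loss n x y b = opt_loss n x y}"
    and "{b. logistic_loss n x y b = opt_loss n x y} \<noteq> {}"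
proof -
  let ?L = "logistic_loss n x y"
  let ?A = "{b. ?L b \<le> ?L 0}"
  have "0 \<in> ?A" by simp
  then have "?A \<noteq> {}" by blast
  then obtain u where u: "u \<in> ?A" "\<And>b. b \<in> ?A \<Longrightarrow> ?L u \<le> ?L b"
    using continuous_attains_inf[OF compact_sublevel_logistic_loss[OF assms] _
        continuous_on_logistic_loss] by metis
  have min: "?L u \<le> ?L b" for b
    using u by (cases "b \<in> ?A") force+
  have opt: "opt_loss n x y = ?L u"
    unfolding opt_loss_def by (rule cInf_eq_minimum) (use min in auto)
  then show "{b. ?L b = opt_loss n x y} \<noteq> {}" by auto
  have "{b. ?L b = opt_loss n x y} = {b. ?L b \<le> opt_loss n x y}"
    using min by (auto simp: opt intro: antisym)
  then show "compact {b. ?L b = opt_loss n x y}"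
    using compact_sublevel_logistic_loss[OF assms] by simp
qed

lemma dist_opt_attained:
  fixes N :: "real ^ 'p \<Rightarrow> real"
  assumes "is_norm N" "0 < deg_nsep N n x y"
  shows "\<exists>bs. logistic_loss n x y bs = opt_loss n x y \<and> dist_opt N n x y b = N (b - bs)"
    and "logistic_loss n x y bs = opt_loss n x y \<Longrightarrow> dist_opt N n x y b \<le> N (b - bs)"
proof -
  let ?S = "{bs. logistic_loss n x y bs = opt_loss n x y}"
  have "continuous_on ?S (\<lambda>bs. N (b - bs))"
    by (intro continuous_on_compose2[OF is_norm_continuous[OF assms(1), of UNIV]]
        continuous_intros) auto
  then obtain u where u: "u \<in> ?S" "\<And>bs. bs \<in> ?S \<Longrightarrow> N (b - u) \<le> N (b - bs)"
    using continuous_attains_inf[OF compact_optimal_logistic_loss[OF assms]] by metis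
  have "dist_opt N n x y b = N (b - u)"
    unfolding dist_opt_def by (rule cInf_eq_minimum) (use u in auto)
  with u show "\<exists>bs. logistic_loss n x y bs = opt_loss n x y \<and> dist_opt N n x y b = N (b - bs)"
    and "logistic_loss n x y bs = opt_loss n x y \<Longrightarrow> dist_opt N n x y b \<le> N (b - bs)"
    by auto
qed

lemma dist0_attained:
  fixes N :: "real ^ 'p \<Rightarrow> real"
  assumes "is_norm N" "0 < deg_nsep N n x y"
  shows "\<exists>b. logistic_loss n x y b \<le> ln 2 \<and> dist0 N n x y = dist_opt N n x y b"
    and "logistic_loss n x y b \<le> ln 2 \<Longrightarrow> dist_opt N n x y b \<le> dist0 N n x y"
proof -
  let ?d = "dist_opt N n x y"
  let ?A = "{b. logistic_loss n x y b \<le> ln 2}"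
  have le: "?d a \<le> N (a - b) + ?d b" for a b
  proof -
    obtain bs where bs: "logistic_loss n x y bs = opt_loss n x y" "?d b = N (b - bs)"
      using dist_opt_attained(1)[OF assms] by blast
    have "?d a \<le> N ((a - b) + (b - bs))"
      using dist_opt_attained(2)[OF assms bs(1), of a] by simp
    also have "\<dots> \<le> N (a - b) + N (b - bs)"
      using assms(1) unfolding is_norm_def by blast
    finally show ?thesis using bs by simp
  qed
  have lip: "norm (?d b - ?d a) \<le> N (b - a)" for a b
    using le[of a b] le[of b a] is_norm_minus_commute[OF assms(1), of a b] by simp
  have N0: "N 0 = 0" using assms(1) unfolding is_norm_def by blast
  have "isCont ?d a" for a
  proof -
    have "continuous_on UNIV (\<lambda>b. N (b - a))"
      by (intro continuous_on_compose2[OF is_norm_continuous[OF assms(1), of UNIV]]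
          continuous_intros) auto
    then have "isCont (\<lambda>b. N (b - a)) a"
      by (simp add: continuous_on_eq_continuous_at)
    then have "((\<lambda>b. N (b - a)) \<longlongrightarrow> N (a - a)) (at a)"
      by (rule isContD)
    then have lim: "((\<lambda>b. N (b - a)) \<longlongrightarrow> 0) (at a)"
      by (simp only: diff_self N0)
    have "((\<lambda>b. ?d b - ?d a) \<longlongrightarrow> 0) (at a)"
      by (rule Lim_null_comparison[OF always_eventually lim]) (use lip in blast)
    then show ?thesis
      by (simp add: isCont_def LIM_zero_iff)
  qed
  then have cont: "continuous_on ?A ?d"
    by (simp add: continuous_at_imp_continuous_on)
  have "logistic_loss n x y 0 \<le> ln 2"
    by (cases "n = 0") (auto simp: logistic_loss_def)
  then have "?A \<noteq> {}" by blast
  then obtain u where u: "u \<in> ?A" "\<And>b. b \<in> ?A \<Longrightarrow> ?d b \<le> ?d u"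
    using continuous_attains_sup[OF compact_sublevel_logistic_loss[OF assms] _ cont] by metis
  have "dist0 N n x y = ?d u"
    unfolding dist0_def by (rule cSup_eq_maximum) (use u in auto)
  with u show "\<exists>b. logistic_loss n x y b \<le> ln 2 \<and> dist0 N n x y = dist_opt N n x y b"
    and "logistic_loss n x y b \<le> ln 2 \<Longrightarrow> dist_opt N n x y b \<le> dist0 N n x y"
    by auto
qed

end

theory Submission
  imports Defs
begin

text \<open>
  Positivity of the degree of non-separability forces the data vectors to span: a direction
  orthogonal to all of them would have zero misclassification. Hence the loss is strictly convex,
  and its Hessian, a positively weighted sum of the matrices \<open>x\<^sub>k x\<^sub>k\<^sup>T\<close>, is positive definite. The
  norm bounds come from \<open>[t]\<^sup>- \<le> ln (1 + exp (-t))\<close>, which after scaling gives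
  \<open>DegNSEP\<^sup>* \<cdot> N \<beta> \<le> L\<^sub>n \<beta>\<close>; the distance bound then is the triangle inequality.
\<close>

text \<open>With \<open>p = exp (a / 2)\<close> and \<open>q = exp (b / 2)\<close>, both sides
  become logarithms of the two sides of (1 + p^2)(1 + q^2) = (1 + pq)^2 + (p - q)^2. The gap is a
  square that vanishes only for \<open>a = b\<close>, which gives the strict version as
  well.\<close>

lemma softplus_midpoint:
  fixes a b :: real
  shows "2 * ln (1 + exp ((a + b) / 2)) \<le> ln (1 + exp a) + ln (1 + exp b)"
    and "a \<noteq> b \<Longrightarrow> 2 * ln (1 + exp ((a + b) / 2)) < ln (1 + exp a) + ln (1 + exp b)"
proof -
  define p q where "p = exp (a / 2)" and "q = exp (b / 2)"
  have exps: "exp a = p\<^sup>2" "exp b = q\<^sup>2" "exp ((a + b) / 2) = p * q"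
    by (simp_all add: p_def q_def power2_eq_square exp_add[symmetric] add_divide_distrib)
  have pos: "0 < p" "0 < q" by (simp_all add: p_def q_def)
  have l: "2 * ln (1 + exp ((a + b) / 2)) = ln ((1 + p * q)\<^sup>2)"
    using pos by (simp add: exps ln_realpow add_pos_pos)
  have r: "ln (1 + exp a) + ln (1 + exp b) = ln ((1 + p\<^sup>2) * (1 + q\<^sup>2))"
    by (simp add: exps ln_mult_pos add_pos_nonneg)
  have eq: "(1 + p\<^sup>2) * (1 + q\<^sup>2) = (1 + p * q)\<^sup>2 + (p - q)\<^sup>2"
    by (simp add: power2_eq_square algebra_simps)
  have base: "0 < (1 + p * q)\<^sup>2" using pos by (intro zero_less_power add_pos_pos mult_pos_pos) auto
  show "2 * ln (1 + exp ((a + b) / 2)) \<le> ln (1 + exp a) + ln (1 + exp b)"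
    unfolding l r eq using base by (intro ln_mono) auto
  assume "a \<noteq> b"
  then have "p \<noteq> q" by (simp add: p_def q_def)
  then have "0 < (p - q)\<^sup>2" by simp
  with base show "2 * ln (1 + exp ((a + b) / 2)) < ln (1 + exp a) + ln (1 + exp b)"
    unfolding l r eq by (subst ln_less_cancel_iff) (auto intro: add_pos_pos)
qed

lemma deg_nsep_pos_spanning:
  fixes N :: "real ^ 'p \<Rightarrow> real"
  assumes "is_norm N" "0 < deg_nsep N n x y" "v \<noteq> 0"
  obtains k where "k \<in> {1..n}" "v \<bullet> x k \<noteq> 0"
proof (rule ccontr)
  assume "\<not> thesis"
  with that have orth: "v \<bullet> x k = 0" if "k \<in> {1..n}" for k
    using that by blast
  have Nv: "0 < N v"
    using assms(1,3) unfolding is_norm_def by (metis less_le)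
  \<comment> \<open>\<open>deg_nsep\<close> ranges over the unit sphere of \<open>N\<close> only, so
    \<open>v\<close> is rescaled before it serves as a competitor.\<close>
  have "N ((1 / N v) *\<^sub>R v) = \<bar>1 / N v\<bar> * N v"
    using assms(1) unfolding is_norm_def by blast
  also have "\<dots> = 1" using Nv by simp
  finally have "deg_nsep N n x y \<le>
      1 / real n * (\<Sum>i=1..n. neg_part (y i * ((1 / N v) *\<^sub>R v \<bullet> x i)))"
    by (rule deg_nsep_attained(2)[OF assms(1)])
  also have "(\<Sum>i=1..n. neg_part (y i * ((1 / N v) *\<^sub>R v \<bullet> x i))) = 0"
    by (intro sum.neutral) (simp add: orth neg_part_def)
  finally show False using assms(2) by simp
qed

text \<open>Summing the midpoint inequality over the data keeps it strict as soon as the margins of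
  \<open>u\<close> and \<open>v\<close> differ at a single index \<open>k\<close>.\<close>

lemma logistic_loss_midpoint_less:
  fixes x :: "nat \<Rightarrow> real ^ 'p"
  assumes "k \<in> {1..n}" "y k \<noteq> 0" "(u - v) \<bullet> x k \<noteq> 0"
  shows "2 * logistic_loss n x y ((1 / 2) *\<^sub>R (u + v)) < logistic_loss n x y u + logistic_loss n x y v"
proof -
  let ?m = "\<lambda>b i. - y i * (b \<bullet> x i)"
  have mid: "?m ((1 / 2) *\<^sub>R (u + v)) i = (?m u i + ?m v i) / 2" for i
    by (simp add: inner_add_left algebra_simps)
  have "?m u k \<noteq> ?m v k"
    using assms(2,3) by (simp add: inner_diff_left)
  then have "(\<Sum>i=1..n. 2 * ln (1 + exp ((?m u i + ?m v i) / 2)))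
      < (\<Sum>i=1..n. ln (1 + exp (?m u i)) + ln (1 + exp (?m v i)))"
    by (intro sum_strict_mono_ex1 bexI[OF _ assms(1)] ballI softplus_midpoint) auto
  moreover have "0 < real n" using assms(1) by simp
  ultimately have "1 / real n * (\<Sum>i=1..n. 2 * ln (1 + exp ((?m u i + ?m v i) / 2)))
      < 1 / real n * (\<Sum>i=1..n. ln (1 + exp (?m u i)) + ln (1 + exp (?m v i)))"
    by (intro mult_strict_left_mono) auto
  then show ?thesis
    unfolding logistic_loss_def mid
    by (simp only: sum.distrib sum_distrib_left[symmetric] distrib_left mult.left_commute)
qed

lemma DERIV_softplus: "((\<lambda>t. ln (1 + exp t)) has_real_derivative exp t / (1 + exp t)) (at t)"
  by (auto intro!: derivative_eq_intros simp: add_pos_pos)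

lemma DERIV_sigmoid:
  "((\<lambda>t. exp t / (1 + exp t)) has_real_derivative exp t / (1 + exp t)\<^sup>2) (at t)"
proof -
  have "1 + exp t \<noteq> 0" using exp_gt_zero[of t] by linarith
  then show ?thesis
    by (auto intro!: derivative_eq_intros simp: power2_eq_square algebra_simps)
qed

text \<open>Along the \<open>j\<close>-th axis each argument of \<open>g\<close> is affine with
  slope \<open>- y k * x k $ j\<close>, so this is the chain rule termwise. The weights
  \<open>w\<close> let the lemma be applied twice: with softplus and weight 1 for the gradient, then
  with the sigmoid and the slopes left over from the first step as weights.\<close>

lemma partial_deriv_sum_ridge:
  fixes x :: "nat \<Rightarrow> real ^ 'p"
  assumes "\<And>t. (g has_real_derivative g' t) (at t)"
  shows "partial_deriv j (\<lambda>b. c * (\<Sum>k\<in>A. w k * g (- y k * (b \<bullet> x k)))) b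
    = c * (\<Sum>k\<in>A. w k * (g' (- y k * (b \<bullet> x k)) * (- y k * x k $ j)))"
proof -
  have arg: "((\<lambda>t. - y k * ((b + t *\<^sub>R axis j 1) \<bullet> x k)) has_real_derivative - y k * x k $ j) (at 0)"
    for k
    by (auto intro!: derivative_eq_intros simp: inner_add_left inner_axis')
  have "((\<lambda>t. g (- y k * ((b + t *\<^sub>R axis j 1) \<bullet> x k))) has_real_derivative
      g' (- y k * (b \<bullet> x k)) * (- y k * x k $ j)) (at 0)" for k
    using DERIV_chain2[OF assms arg[of k]] by simp
  then show ?thesis
    unfolding partial_deriv_def
    by (intro DERIV_imp_deriv DERIV_cmult DERIV_sum) auto
qed

lemma hessian_logistic_loss:
  fixes x :: "nat \<Rightarrow> real ^ 'p"
  defines "s \<equiv> \<lambda>t::real. exp t / (1 + exp t)\<^sup>2"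
  shows "hessian (logistic_loss n x y) b $ i $ j
    = 1 / real n * (\<Sum>k=1..n. s (- y k * (b \<bullet> x k)) * (y k)\<^sup>2 * (x k $ i * x k $ j))"
proof -
  let ?sig = "\<lambda>t::real. exp t / (1 + exp t)"
  have "partial_deriv j (logistic_loss n x y) b
      = 1 / real n * (\<Sum>k=1..n. (- y k * x k $ j) * ?sig (- y k * (b \<bullet> x k)))" for b
    using partial_deriv_sum_ridge[OF DERIV_softplus, of j "1 / real n" "\<lambda>_. 1" y x "{1..n}" b]
    by (simp only: logistic_loss_def[abs_def] mult_1 mult.commute[of "- y _ * x _ $ j"])
  then have "partial_deriv j (logistic_loss n x y)
      = (\<lambda>b. 1 / real n * (\<Sum>k=1..n. (- y k * x k $ j) * ?sig (- y k * (b \<bullet> x k))))"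
    by (rule ext)
  then have "hessian (logistic_loss n x y) b $ i $ j = partial_deriv i
      (\<lambda>b. 1 / real n * (\<Sum>k=1..n. (- y k * x k $ j) * ?sig (- y k * (b \<bullet> x k)))) b"
    by (simp only: hessian_def vec_lambda_beta)
  also have "\<dots> = 1 / real n *
      (\<Sum>k=1..n. (- y k * x k $ j) * (s (- y k * (b \<bullet> x k)) * (- y k * x k $ i)))"
    unfolding s_def by (rule partial_deriv_sum_ridge[OF DERIV_sigmoid])
  also have "\<dots> = 1 / real n *
      (\<Sum>k=1..n. s (- y k * (b \<bullet> x k)) * (y k)\<^sup>2 * (x k $ i * x k $ j))"
    by (simp add: power2_eq_square mult_ac)
  finally show ?thesis .
qed

text \<open>Each rank-one matrix built from \<open>x k\<close> has the quadratic form (v . x k)^2.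
  Moving the sum over \<open>k\<close> outermost lets the double sum over coordinates factor into
  this square.\<close>

lemma inner_matrix_sum_outer:
  fixes A :: "real ^ 'p ^ 'p" and x :: "'k \<Rightarrow> real ^ 'p"
  assumes "\<And>i j. A $ i $ j = c * (\<Sum>k\<in>K. w k * (x k $ i * x k $ j))"
  shows "v \<bullet> (A *v v) = c * (\<Sum>k\<in>K. w k * (v \<bullet> x k)\<^sup>2)"
proof -
  have "v \<bullet> (A *v v) = (\<Sum>i\<in>UNIV. \<Sum>j\<in>UNIV. \<Sum>k\<in>K. c * (w k * ((v $ i * x k $ i) * (v $ j * x k $ j))))"
    by (simp add: inner_vec_def matrix_vector_mult_def assms sum_distrib_left sum_distrib_right mult_ac)
  also have "\<dots> = (\<Sum>i\<in>UNIV. \<Sum>k\<in>K. \<Sum>j\<in>UNIV. c * (w k * ((v $ i * x k $ i) * (v $ j * x k $ j))))"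
    by (intro sum.cong[OF refl] sum.swap)
  also have "\<dots> = (\<Sum>k\<in>K. \<Sum>i\<in>UNIV. \<Sum>j\<in>UNIV. c * (w k * ((v $ i * x k $ i) * (v $ j * x k $ j))))"
    by (rule sum.swap)
  also have "\<dots> = c * (\<Sum>k\<in>K. w k * (v \<bullet> x k)\<^sup>2)"
    by (simp only: inner_vec_def inner_real_def power2_eq_square sum_product)
      (simp only: sum_distrib_left)
  finally show ?thesis .
qed

text \<open>The Hessian's quadratic form has nonnegative terms at any \<open>b\<close>, and the
  spanning assumption supplies one that is strictly positive.\<close>

lemma pos_def_hessian_logistic_loss:
  fixes x :: "nat \<Rightarrow> real ^ 'p"
  assumes span: "\<And>v. v \<noteq> 0 \<Longrightarrow> \<exists>k\<in>{1..n}. y k \<noteq> 0 \<and> v \<bullet> x k \<noteq> 0"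
  shows "pos_def (hessian (logistic_loss n x y) b)"
  unfolding pos_def_def
proof (intro conjI allI impI)
  show "transpose (hessian (logistic_loss n x y) b) = hessian (logistic_loss n x y) b"
    by (simp add: vec_eq_iff transpose_def hessian_logistic_loss mult.commute)
  fix v :: "real ^ 'p"
  assume "v \<noteq> 0"
  then obtain k where k: "k \<in> {1..n}" "y k \<noteq> 0" "v \<bullet> x k \<noteq> 0"
    using span by blast
  let ?w = "\<lambda>k. exp (- y k * (b \<bullet> x k)) / (1 + exp (- y k * (b \<bullet> x k)))\<^sup>2 * (y k)\<^sup>2"
  have "1 + exp (- y k * (b \<bullet> x k)) \<noteq> 0"
    using exp_gt_zero[of "- y k * (b \<bullet> x k)"] by linarith
  then have "0 < ?w k * (v \<bullet> x k)\<^sup>2"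
    using k by (intro mult_pos_pos divide_pos_pos) auto
  then have "0 < (\<Sum>k=1..n. ?w k * (v \<bullet> x k)\<^sup>2)"
    by (intro sum_pos2[OF _ k(1)]) auto
  moreover have "0 < real n" using k(1) by simp
  ultimately show "0 < v \<bullet> (hessian (logistic_loss n x y) b *v v)"
    by (subst inner_matrix_sum_outer[OF hessian_logistic_loss]) simp
qed

theorem proposition2p1:
  fixes N :: "real ^ 'p \<Rightarrow> real"
    and n :: nat
    and x :: "nat \<Rightarrow> real ^ 'p"
    and y :: "nat \<Rightarrow> real"
  assumes "is_norm N"
    and "1 \<le> n"
    and "\<And>i. i \<in> {1..n} \<Longrightarrow> y i \<in> {-1, 1}"
    and "deg_nsep N n x y > 0"
  shows "(\<exists>!bs. is_arg_min (logistic_loss n x y) (\<lambda>_. True) bs) \<and>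
    (\<forall>bs. is_arg_min (logistic_loss n x y) (\<lambda>_. True) bs \<longrightarrow>
       pos_def (hessian (logistic_loss n x y) bs) \<and>
       N bs \<le> opt_loss n x y / deg_nsep N n x y) \<and>
    opt_loss n x y / deg_nsep N n x y \<le> ln 2 / deg_nsep N n x y \<and>
    dist0 N n x y \<le> (ln 2 + opt_loss n x y) / deg_nsep N n x y \<and>
    (ln 2 + opt_loss n x y) / deg_nsep N n x y \<le> 2 * ln 2 / deg_nsep N n x y"
proof -
  let ?L = "logistic_loss n x y" and ?D = "deg_nsep N n x y" and ?o = "opt_loss n x y"
  have y0: "y k \<noteq> 0" if "k \<in> {1..n}" for k
    using assms(3)[OF that] by auto
  have span: "\<exists>k\<in>{1..n}. y k \<noteq> 0 \<and> v \<bullet> x k \<noteq> 0" if "v \<noteq> 0" for v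
    using deg_nsep_pos_spanning[OF assms(1,4) that] y0 by metis
  have lower: "?D * N b \<le> ?L b" for b
    by (rule deg_nsep_le_logistic_loss[OF assms(1)])
  have N_nonneg: "0 \<le> N b" for b
    using assms(1) unfolding is_norm_def by blast
  have "0 \<le> ?L b" for b
    using lower[of b] N_nonneg[of b] assms(4) by (meson less_imp_le mult_nonneg_nonneg order_trans)
  \<comment> \<open>A real \<open>INF\<close> is known to be a lower bound only once the range is
    bounded below.\<close>
  then have "bdd_below (range ?L)" by (intro bdd_belowI2)
  then have opt_le: "?o \<le> ?L b" for b
    unfolding opt_loss_def by (rule cINF_lower) simp
  obtain u where u: "?L u = ?o"
    using compact_optimal_logistic_loss(2)[OF assms(1,4)] by blast
  have min_iff: "is_arg_min ?L (\<lambda>_. True) b \<longleftrightarrow> ?L b = ?o" for b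
    using opt_le u by (auto simp: is_arg_min_def not_less intro: antisym) (metis antisym)
  \<comment> \<open>The midpoint of two distinct minimisers would have loss strictly below the
    infimum.\<close>
  have unique: "b = u" if b: "?L b = ?o" for b
  proof (rule ccontr)
    assume "b \<noteq> u"
    then obtain k where "k \<in> {1..n}" "y k \<noteq> 0" "(b - u) \<bullet> x k \<noteq> 0"
      using span[of "b - u"] by auto
    then have "2 * ?L ((1 / 2) *\<^sub>R (b + u)) < ?L b + ?L u"
      by (rule logistic_loss_midpoint_less)
    then show False using opt_le[of "(1 / 2) *\<^sub>R (b + u)"] b u by simp
  qed
  \<comment> \<open>Used with \<open>c = ?o\<close> for minimisers and with \<open>c = ln 2\<close>
    for the sublevel set in \<open>dist0\<close>.\<close>
  have bound: "N b \<le> c / ?D" if "?L b \<le> c" for b c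
    using order_trans[OF lower that] assms(4) by (simp add: field_simps)
  have "?L 0 = ln 2" using assms(2) by (simp add: logistic_loss_def)
  then have opt_ln2: "?o \<le> ln 2" using opt_le[of 0] by simp
  \<comment> \<open>Since the supremum is attained, it suffices to bound the distance from this one
    \<open>b\<close> to the minimiser \<open>u\<close> by \<open>N b + N u\<close>.\<close>
  obtain b where b: "?L b \<le> ln 2" "dist0 N n x y = dist_opt N n x y b"
    using dist0_attained(1)[OF assms(1,4)] by blast
  \<comment> \<open>Homogeneity with scalar -1 gives \<open>N (- u) = N u\<close>, so the triangle
    inequality applies to the difference.\<close>
  have "N (- 1 *\<^sub>R u) = \<bar>- 1\<bar> * N u"
    using assms(1) unfolding is_norm_def by blast
  then have "N (b + - u) \<le> N b + N u"
    using assms(1) unfolding is_norm_def by (metis abs_minus_cancel abs_one mult_1 scaleR_minus1_left)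
  then have "dist_opt N n x y b \<le> ln 2 / ?D + ?o / ?D"
    using dist_opt_attained(2)[OF assms(1,4) u, of b] bound[OF b(1)] bound[of u ?o] u by simp
  then have dist: "dist0 N n x y \<le> (ln 2 + ?o) / ?D"
    by (simp add: b(2) add_divide_distrib)
  have "\<exists>!bs. ?L bs = ?o" using u unique by blast
  moreover have "pos_def (hessian ?L b)" for b
    by (rule pos_def_hessian_logistic_loss[OF span])
  moreover have "?o / ?D \<le> ln 2 / ?D" "(ln 2 + ?o) / ?D \<le> 2 * ln 2 / ?D"
    using opt_ln2 assms(4) by (auto intro: divide_right_mono)
  moreover have "N b \<le> ?o / ?D" if "?L b = ?o" for b
    using bound[of b ?o] that by simp
  moreover note dist
  ultimately show ?thesis
    unfolding min_iff by blast
qed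

end
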